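(* Let $n\ge 1$, let $f,g:\{0,1\}^n\rightarrow\{-1,0,1\}$, $0< p\leq \frac{1}{2}$, and $0<\alpha\leq 1$. Let $\tilde{A}(\alpha,p)$ be a real number such that $\max\big(A(\alpha,p),\,(1-p)\,4^{\alpha p}\big)\leq\tilde{A}(\alpha,p)$. Then $$\mathrm{E}_{S\sim \mu_p}\big(\hat{f}(S)\,\hat{g}(S)\big)\leq 4^{-n}\,\tilde{A}(\alpha,p)^n\,\big(|\mathrm{Supp}(f)|\cdot |\mathrm{Supp}(g)|\big)^{1-\alpha p}.$$
   Context: For $f:\{0,1\}^n\to\mathbb{R}$ and $S\subseteq[n]=\{1,\dots,n\}$, the Fourier coefficient is $\hat{f}(S):=\mathrm{E}_{x}\big(f(x)\,(-1)^{\bigoplus_{i\in S}x_i}\big)$ with $x$ uniform in $\{0,1\}^n$ (and $\bigoplus_{i\in\emptyset}x_i:=0$). $\mathrm{Supp}(f)$ is the set of points where $f$ is non-zero. $\mu_p$ is the distribution on subsets $S\subseteq[n]$ in which each element of $[n]$ is included independently with probability $p$. Define $$A(\alpha,p):=\sup_{0\leq x\leq 1} \frac{\big\|(1-2px,\;1-2p(1-x))\big\|_{\frac{1}{\alpha p}}}{\big\|(x,\,1-x)\big\|_{\frac{1}{1-\alpha p}}},$$ where $\|(a,b)\|_q=(|a|^q+|b|^q)^{1/q}$ (norms with respect to the counting measure). *)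

theory Defs
  imports "HOL-Probability.Probability"
begin

definition cube :: "nat \<Rightarrow> (nat \<Rightarrow> nat) set" where
  "cube n = {1..n} \<rightarrow>\<^sub>E {0, 1}"

definition fourier_coeff :: "nat \<Rightarrow> ((nat \<Rightarrow> nat) \<Rightarrow> real) \<Rightarrow> nat set \<Rightarrow> real" where
  "fourier_coeff n f S =
     measure_pmf.expectation (pmf_of_set (cube n)) (\<lambda>x. f x * (- 1) ^ ((\<Sum>i\<in>S. x i) mod 2))"

definition Supp :: "nat \<Rightarrow> ((nat \<Rightarrow> nat) \<Rightarrow> real) \<Rightarrow> (nat \<Rightarrow> nat) set" where
  "Supp n f = {x \<in> cube n. f x \<noteq> 0}"

definition random_subset :: "nat \<Rightarrow> real \<Rightarrow> nat set pmf" where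
  "random_subset n p =
     map_pmf (\<lambda>b. {i \<in> {1..n}. b i}) (Pi_pmf {1..n} False (\<lambda>_. bernoulli_pmf p))"

definition norm_pair :: "real \<Rightarrow> real \<times> real \<Rightarrow> real" where
  "norm_pair q = (\<lambda>(a, b). (\<bar>a\<bar> powr q + \<bar>b\<bar> powr q) powr (1 / q))"

definition A_ratio :: "real \<Rightarrow> real \<Rightarrow> real \<Rightarrow> real" where
  "A_ratio \<alpha> p x =
     norm_pair (1 / (\<alpha> * p)) (1 - 2 * p * x, 1 - 2 * p * (1 - x)) /
     norm_pair (1 / (1 - \<alpha> * p)) (x, 1 - x)"

text \<open>The supremum of a set of reals is meaningful only if the set is bounded; see
  \<open>bdd_above_A_ratio\<close> below.\<close>

definition A_sup :: "real \<Rightarrow> real \<Rightarrow> real" where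
  "A_sup \<alpha> p = (SUP x\<in>{0..1}. A_ratio \<alpha> p x)"

lemma bdd_above_A_ratio:
  assumes "0 < p" "p \<le> 1 / 2" "0 < \<alpha>" "\<alpha> \<le> 1"
  shows "bdd_above (A_ratio \<alpha> p ` {0..1})"
proof -
  have "\<alpha> * p \<le> 1 * (1 / 2)"
    using assms by (intro mult_mono) auto
  then have a: "0 < \<alpha> * p" "\<alpha> * p < 1"
    using assms by auto
  have pos: "\<bar>x\<bar> powr q + \<bar>1 - x\<bar> powr q > 0" for x q :: real
  proof (cases "x = 0")
    case False
    then have "\<bar>x\<bar> powr q > 0" by simp
    then show ?thesis by (intro add_pos_nonneg) auto
  qed auto
  have nonzero: "norm_pair q (x, 1 - x) \<noteq> 0" for x q :: real
    using pos[of x q] unfolding norm_pair_def by simp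
  have cont: "continuous_on {0..1} (\<lambda>x. norm_pair q (u x, v x))"
    if "continuous_on {0..1} u" "continuous_on {0..1} v" "0 < q" for u v :: "real \<Rightarrow> real" and q
    unfolding norm_pair_def split_conv
    by (rule continuous_on_powr' continuous_on_add continuous_on_rabs continuous_on_const
        that(1) that(2) | use that(3) in simp)+
  have "continuous_on {0..1} (A_ratio \<alpha> p)"
    unfolding A_ratio_def
    by (rule continuous_on_divide) (use a nonzero in \<open>auto intro!: cont continuous_intros\<close>)
  then have "compact (A_ratio \<alpha> p ` {0..1})"
    by (rule compact_continuous_image) auto
  then show ?thesis
    by (intro bounded_imp_bdd_above compact_imp_bounded)
qed

end

theory Submission
  imports Defs
begin

text \<open>
  Expanding the Fourier coefficients and averaging over \<open>S\<close> turns the left-hand side into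
  \<open>4\<^sup>-\<^sup>n\<close> times the bilinear form of \<open>f\<close> and \<open>g\<close> whose kernel is the \<open>n\<close>-fold tensor power of
  \<open>k(s, t) = (1 - p) + p (-1)\<^sup>s\<^sup>+\<^sup>t\<close>. By \<open>\<ell>\<^sup>q\<close> duality, \<open>A(\<alpha>, p)\<close> bounds the one-coordinate form of \<open>k\<close>
  on non-negative pairs with respect to the \<open>\<ell>\<^sup>q\<close> norm, \<open>q = 1 / (1 - \<alpha> p)\<close>, in both arguments.
  Such a bound is inherited by tensor powers, and the \<open>q\<close>-th powers of \<open>|f|\<close> and \<open>|g|\<close> are the
  indicators of the supports.
\<close>

section \<open>Hoelder's inequality for finite sums\<close>

text \<open>Young's inequality is applied termwise after dividing both sequences by their norms
  \<open>u\<close> and \<open>v\<close>. The case of a vanishing norm is split off because of these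
  divisions.\<close>

lemma Holder_inequality_sum:
  fixes a b :: "'a \<Rightarrow> real"
  assumes "finite I" "p > 1" "q > 1" "1 / p + 1 / q = 1"
    and "\<And>i. i \<in> I \<Longrightarrow> a i \<ge> 0" "\<And>i. i \<in> I \<Longrightarrow> b i \<ge> 0"
  shows "(\<Sum>i\<in>I. a i * b i) \<le> (\<Sum>i\<in>I. a i powr p) powr (1 / p) * (\<Sum>i\<in>I. b i powr q) powr (1 / q)"
proof (cases "(\<Sum>i\<in>I. a i powr p) = 0 \<or> (\<Sum>i\<in>I. b i powr q) = 0")
  case True
  then have "(\<forall>i\<in>I. a i = 0) \<or> (\<forall>i\<in>I. b i = 0)"
    using assms by (auto simp: sum_nonneg_eq_0_iff)
  then have "(\<Sum>i\<in>I. a i * b i) = 0"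
    by (intro sum.neutral) auto
  then show ?thesis by simp
next
  case False
  define U where "U = (\<Sum>i\<in>I. a i powr p)"
  define V where "V = (\<Sum>i\<in>I. b i powr q)"
  have U: "U > 0" and V: "V > 0"
    using False unfolding U_def V_def by (simp_all add: less_le sum_nonneg)
  define u where "u = U powr (1 / p)"
  define v where "v = V powr (1 / q)"
  have u: "u > 0" "u powr p = U" and v: "v > 0" "v powr q = V"
    using U V assms by (auto simp: u_def v_def powr_powr)
  have "(\<Sum>i\<in>I. a i * b i) = (\<Sum>i\<in>I. u * v * (a i / u * (b i / v)))"
    using u v by (intro sum.cong) auto
  also have "\<dots> \<le> (\<Sum>i\<in>I. u * v * ((a i / u) powr p / p + (b i / v) powr q / q))"
    using u v assms by (intro sum_mono mult_left_mono Youngs_inequality) auto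
  also have "\<dots> = (\<Sum>i\<in>I. u * v * (a i powr p / (U * p) + b i powr q / (V * q)))"
    using u v assms by (intro sum.cong) (auto simp: powr_divide)
  also have "\<dots> = u * v * (U / (U * p) + V / (V * q))"
    by (simp add: U_def V_def sum.distrib flip: sum_distrib_left sum_divide_distrib)
  also have "\<dots> = u * v"
    using U V assms(4) by simp
  finally show ?thesis by (simp add: u_def v_def U_def V_def)
qed

section \<open>Passing from one coordinate to tensor powers\<close>

lemma sum_PiE_insert:
  assumes "i \<notin> I"
  shows "(\<Sum>x\<in>PiE (insert i I) B. h x) = (\<Sum>s\<in>B i. \<Sum>x\<in>PiE I B. h (x(i := s)))"
  unfolding PiE_insert_eq sum.reindex[OF inj_combinator[OF assms]] sum.cartesian_product
  by (simp add: case_prod_unfold o_def)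

text \<open>Fix the values \<open>s\<close>, \<open>t\<close> of a new coordinate: the induction
  hypothesis bounds the remaining form by the norms of the slices of \<open>u\<close> and
  \<open>v\<close>, and \<open>k s t\<close> \<ge> 0 preserves this bound. Then \<open>one\<close>
  applies to the slice norms as functions of \<open>s\<close> and \<open>t\<close>. Taking the same
  norm of slice norms gives back the full norm, so the constants simply multiply.\<close>

lemma tensor_bilinear_bound:
  fixes k :: "'b \<Rightarrow> 'b \<Rightarrow> real" and u v :: "('a \<Rightarrow> 'b) \<Rightarrow> real"
  assumes "finite I" and "r \<noteq> 0" and k: "\<And>s t. s \<in> B \<Longrightarrow> t \<in> B \<Longrightarrow> k s t \<ge> 0" and "C \<ge> 0"
    and one: "\<And>a b :: 'b \<Rightarrow> real. (\<And>s. s \<in> B \<Longrightarrow> a s \<ge> 0) \<Longrightarrow> (\<And>s. s \<in> B \<Longrightarrow> b s \<ge> 0) \<Longrightarrow>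
      (\<Sum>s\<in>B. \<Sum>t\<in>B. k s t * a s * b t)
        \<le> C * (\<Sum>s\<in>B. a s powr (1 / r)) powr r * (\<Sum>s\<in>B. b s powr (1 / r)) powr r"
    and "\<And>x. u x \<ge> 0" "\<And>x. v x \<ge> 0"
  shows "(\<Sum>x\<in>I \<rightarrow>\<^sub>E B. \<Sum>y\<in>I \<rightarrow>\<^sub>E B. u x * v y * (\<Prod>i\<in>I. k (x i) (y i)))
    \<le> C ^ card I * (\<Sum>x\<in>I \<rightarrow>\<^sub>E B. u x powr (1 / r)) powr r * (\<Sum>x\<in>I \<rightarrow>\<^sub>E B. v x powr (1 / r)) powr r"
  using assms(1,6,7)
proof (induction I arbitrary: u v rule: finite_induct)
  case empty
  then show ?case using \<open>r \<noteq> 0\<close> by (simp add: powr_powr)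
next
  case (insert i I)
  let ?P = "I \<rightarrow>\<^sub>E B"
  \<comment> \<open>The outer power \<open>r\<close> is left out, so that \<open>N w s\<close>
    summed over \<open>s\<close> is the sum over all of \<open>insert i I\<close>; the slice norm is
    \<open>N w s powr r\<close>.\<close>
  define N :: "(('a \<Rightarrow> 'b) \<Rightarrow> real) \<Rightarrow> 'b \<Rightarrow> real"
    where "N w s = (\<Sum>x\<in>?P. w (x(i := s)) powr (1 / r))" for w s
  have upd: "(\<Prod>j\<in>I. k ((x(i := s)) j) ((y(i := t)) j)) = (\<Prod>j\<in>I. k (x j) (y j))" for x y s t
    using insert.hyps by (intro prod.cong) auto
  have "(\<Sum>x\<in>insert i I \<rightarrow>\<^sub>E B. \<Sum>y\<in>insert i I \<rightarrow>\<^sub>E B. u x * v y * (\<Prod>j\<in>insert i I. k (x j) (y j)))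
      = (\<Sum>s\<in>B. \<Sum>x\<in>?P. \<Sum>t\<in>B. \<Sum>y\<in>?P.
          k s t * (u (x(i := s)) * v (y(i := t)) * (\<Prod>j\<in>I. k (x j) (y j))))"
    using insert.hyps by (simp add: sum_PiE_insert upd mult_ac del: fun_upd_apply) (simp add: mult_ac)
  also have "\<dots> = (\<Sum>s\<in>B. \<Sum>t\<in>B. k s t *
      (\<Sum>x\<in>?P. \<Sum>y\<in>?P. u (x(i := s)) * v (y(i := t)) * (\<Prod>j\<in>I. k (x j) (y j))))"
    unfolding sum_distrib_left by (intro sum.cong refl sum.swap)
  also have "\<dots> \<le> (\<Sum>s\<in>B. \<Sum>t\<in>B. k s t * (C ^ card I * N u s powr r * N v t powr r))"
    unfolding N_def by (intro sum_mono mult_left_mono insert.IH insert.prems k)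
  also have "\<dots> = C ^ card I * (\<Sum>s\<in>B. \<Sum>t\<in>B. k s t * N u s powr r * N v t powr r)"
    by (simp add: sum_distrib_left mult_ac)
  also have "\<dots> \<le> C ^ card I * (C * (\<Sum>s\<in>B. (N u s powr r) powr (1 / r)) powr r
      * (\<Sum>s\<in>B. (N v s powr r) powr (1 / r)) powr r)"
    by (intro mult_left_mono one zero_le_power \<open>C \<ge> 0\<close>) auto
  also have "\<dots> = C ^ card (insert i I) * (\<Sum>s\<in>B. N u s) powr r * (\<Sum>s\<in>B. N v s) powr r"
    using insert.hyps \<open>r \<noteq> 0\<close> by (simp add: powr_powr N_def sum_nonneg)
  also have "\<dots> = C ^ card (insert i I)
      * (\<Sum>x\<in>insert i I \<rightarrow>\<^sub>E B. u x powr (1 / r)) powr r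
      * (\<Sum>x\<in>insert i I \<rightarrow>\<^sub>E B. v x powr (1 / r)) powr r"
    using insert.hyps by (simp add: sum_PiE_insert N_def)
  finally show ?case .
qed

section \<open>The one-coordinate bound\<close>

lemma A_ratio_nonneg: "A_ratio \<alpha> p x \<ge> 0"
  by (simp add: A_ratio_def norm_pair_def)

lemma A_sup_upper:
  assumes "0 < p" "p \<le> 1 / 2" "0 < \<alpha>" "\<alpha> \<le> 1" "x \<in> {0..1}"
  shows "A_ratio \<alpha> p x \<le> A_sup \<alpha> p"
  unfolding A_sup_def using assms by (intro cSUP_upper bdd_above_A_ratio)

lemma norm_pair_scale:
  assumes "c \<ge> 0" "q > 0"
  shows "norm_pair q (c * a, c * b) = c * norm_pair q (a, b)"
proof -
  have "norm_pair q (c * a, c * b) = (c powr q * (\<bar>a\<bar> powr q + \<bar>b\<bar> powr q)) powr (1 / q)"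
    using assms by (simp add: norm_pair_def abs_mult powr_mult distrib_left)
  also have "\<dots> = c * norm_pair q (a, b)"
    using assms by (simp add: norm_pair_def powr_mult powr_powr)
  finally show ?thesis .
qed

text \<open>Both sides are homogeneous of degree 1 in \<open>(a, b)\<close>, so one may scale to
  \<open>a + b = 1\<close>, where the quotient of the two norms is a value of
  \<open>A_ratio\<close>.\<close>

lemma norm_pair_le_A_sup:
  assumes "0 < p" "p \<le> 1 / 2" "0 < \<alpha>" "\<alpha> \<le> 1" "a \<ge> 0" "b \<ge> 0"
  shows "norm_pair (1 / (\<alpha> * p)) (a + (1 - 2 * p) * b, (1 - 2 * p) * a + b)
    \<le> A_sup \<alpha> p * norm_pair (1 / (1 - \<alpha> * p)) (a, b)"
proof (cases "a + b = 0")
  case True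
  with assms have "a = 0" "b = 0" by auto
  then show ?thesis by (simp add: norm_pair_def)
next
  case False
  have "\<alpha> * p \<le> 1 * (1 / 2)"
    using assms by (intro mult_mono) auto
  then have \<beta>: "0 < \<alpha> * p" "\<alpha> * p < 1"
    using assms by auto
  define c where "c = a + b"
  \<comment> \<open>The share of \<open>b\<close> rather than of \<open>a\<close>, because
    \<open>a + (1 - 2 * p) * b = c * (1 - 2 * p * x)\<close>. The denominator of
    \<open>A_ratio\<close> then has its entries in the opposite order, which \<open>swap\<close>
    repairs.\<close>
  define x where "x = b / c"
  have c: "c > 0" using False assms by (simp add: c_def)
  have x: "x \<in> {0..1}" using assms c by (auto simp: x_def c_def)
  have b: "b = c * x" using c by (simp add: x_def)
  have a: "a = c * (1 - x)" using c by (simp add: x_def right_diff_distrib) (simp add: c_def)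
  have swap: "norm_pair q (s, t) = norm_pair q (t, s)" for q s t
    by (simp add: norm_pair_def add.commute)
  have pos: "norm_pair q (x, 1 - x) > 0" for q
  proof -
    have "\<bar>x\<bar> powr q + \<bar>1 - x\<bar> powr q > 0"
      by (cases "x = 0") (auto intro: add_pos_nonneg)
    then show ?thesis by (simp add: norm_pair_def)
  qed
  have "norm_pair (1 / (\<alpha> * p)) (a + (1 - 2 * p) * b, (1 - 2 * p) * a + b)
      = norm_pair (1 / (\<alpha> * p)) (c * (1 - 2 * p * x), c * (1 - 2 * p * (1 - x)))"
    by (simp add: a b algebra_simps)
  also have "\<dots> = c * (A_ratio \<alpha> p x * norm_pair (1 / (1 - \<alpha> * p)) (x, 1 - x))"
    using c \<beta> pos[of "1 / (1 - \<alpha> * p)"] by (subst norm_pair_scale) (auto simp: A_ratio_def)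
  also have "\<dots> \<le> c * (A_sup \<alpha> p * norm_pair (1 / (1 - \<alpha> * p)) (x, 1 - x))"
    using c pos[of "1 / (1 - \<alpha> * p)"] assms x
    by (intro mult_left_mono mult_right_mono A_sup_upper) auto
  also have "\<dots> = A_sup \<alpha> p * norm_pair (1 / (1 - \<alpha> * p)) (a, b)"
    unfolding a b using c \<beta> by (subst norm_pair_scale) (auto simp: swap[of _ x])
  finally show ?thesis .
qed

text \<open>Hoelder with the conjugate exponents \<open>1 / \<beta>\<close> and
  \<open>1 / (1 - \<beta>)\<close> separates \<open>b\<close> from the image of \<open>a\<close>
  under the kernel, whose norm is controlled by \<open>norm_pair_le_A_sup\<close>.\<close>

lemma noise_kernel_bound:
  fixes a b :: "nat \<Rightarrow> real"
  assumes "0 < p" "p \<le> 1 / 2" "0 < \<alpha>" "\<alpha> \<le> 1"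
    and "\<And>s. s \<in> {0, 1} \<Longrightarrow> a s \<ge> 0" "\<And>s. s \<in> {0, 1} \<Longrightarrow> b s \<ge> 0"
  shows "(\<Sum>s\<in>{0, 1}. \<Sum>t\<in>{0, 1}. (1 - p + p * (- 1) ^ (s + t)) * a s * b t)
    \<le> A_sup \<alpha> p * (\<Sum>s\<in>{0, 1}. a s powr (1 / (1 - \<alpha> * p))) powr (1 - \<alpha> * p)
      * (\<Sum>s\<in>{0, 1}. b s powr (1 / (1 - \<alpha> * p))) powr (1 - \<alpha> * p)"
proof -
  define \<beta> where "\<beta> = \<alpha> * p"
  have "\<alpha> * p \<le> 1 * (1 / 2)"
    using assms by (intro mult_mono) auto
  then have \<beta>: "0 < \<beta>" "\<beta> < 1"
    using assms by (auto simp: \<beta>_def)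
  \<comment> \<open>The kernel is 1 on the diagonal and \<open>1 - 2 * p\<close> off it, so
    \<open>T\<close> is the kernel applied to \<open>a\<close>; \<open>1 - s\<close> exchanges 0 and
    1.\<close>
  define T where "T s = a s + (1 - 2 * p) * a (1 - s)" for s
  have ab: "a 0 \<ge> 0" "a 1 \<ge> 0" "b 0 \<ge> 0" "b 1 \<ge> 0" using assms by auto
  have T: "T 0 \<ge> 0" "T 1 \<ge> 0" using ab assms by (auto simp: T_def)
  have "(\<Sum>s\<in>{0, 1}. \<Sum>t\<in>{0, 1}. (1 - p + p * (- 1) ^ (s + t)) * a s * b t) = (\<Sum>t\<in>{0, 1}. T t * b t)"
    by (simp add: T_def algebra_simps)
  also have "\<dots> \<le> (\<Sum>t\<in>{0, 1}. T t powr (1 / \<beta>)) powr (1 / (1 / \<beta>))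
      * (\<Sum>t\<in>{0, 1}. b t powr (1 / (1 - \<beta>))) powr (1 / (1 / (1 - \<beta>)))"
    using T ab \<beta> by (intro Holder_inequality_sum) auto
  also have "(\<Sum>t\<in>{0, 1}. T t powr (1 / \<beta>)) powr (1 / (1 / \<beta>))
      = norm_pair (1 / (\<alpha> * p)) (a 0 + (1 - 2 * p) * a 1, (1 - 2 * p) * a 0 + a 1)"
    using T by (simp add: norm_pair_def T_def \<beta>_def add_ac)
  also have "\<dots> \<le> A_sup \<alpha> p * norm_pair (1 / (1 - \<alpha> * p)) (a 0, a 1)"
    using assms ab by (intro norm_pair_le_A_sup)
  finally show ?thesis
    using ab by (simp add: norm_pair_def \<beta>_def mult_right_mono)
qed

section \<open>The Fourier side as a bilinear form\<close>

text \<open>The coordinates of \<open>Pi_pmf\<close> are independent; finite supports make every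
  function integrable.\<close>

lemma expectation_prod_Pi_pmf_finite:
  fixes h :: "'a \<Rightarrow> 'b \<Rightarrow> real"
  assumes "finite I" "\<And>i. i \<in> I \<Longrightarrow> finite (set_pmf (P i))"
  shows "measure_pmf.expectation (Pi_pmf I d P) (\<lambda>b. \<Prod>i\<in>I. h i (b i))
    = (\<Prod>i\<in>I. measure_pmf.expectation (P i) (h i))"
proof -
  have fin: "finite (set_pmf (Pi_pmf I d P))"
    using assms by (simp add: set_Pi_pmf finite_PiE_dflt)
  have "measure_pmf.expectation (Pi_pmf I d P) (\<lambda>b. \<Prod>i\<in>I. h i (b i))
    = (\<Prod>i\<in>I. measure_pmf.expectation (Pi_pmf I d P) (\<lambda>b. h i (b i)))"
  proof (rule prob_space.indep_vars_lebesgue_integral[OF prob_space_measure_pmf assms(1)])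
    show "prob_space.indep_vars (Pi_pmf I d P) (\<lambda>_. borel) (\<lambda>i b. h i (b i)) I"
      by (rule prob_space.indep_vars_compose2[OF prob_space_measure_pmf indep_vars_Pi_pmf[OF assms(1)]]) auto
  qed (auto intro: integrable_measure_pmf_finite fin)
  also have "\<dots> = (\<Prod>i\<in>I. measure_pmf.expectation (map_pmf (\<lambda>b. b i) (Pi_pmf I d P)) (h i))"
    by simp
  also have "\<dots> = (\<Prod>i\<in>I. measure_pmf.expectation (P i) (h i))"
    using assms by (intro prod.cong refl) (subst Pi_pmf_component, auto)
  finally show ?thesis .
qed

lemma finite_cube: "finite (cube n)"
  by (simp add: cube_def finite_PiE)

text \<open>The character becomes a product over all of \<open>{1..n}\<close>, with factor 1 outside
  \<open>S\<close>, so that averaging over \<open>S\<close> can be done coordinate by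
  coordinate.\<close>

lemma fourier_coeff_eq_sum:
  assumes "S \<subseteq> {1..n}"
  shows "fourier_coeff n f S = (\<Sum>x\<in>cube n. f x * (\<Prod>i=1..n. if i \<in> S then (- 1) ^ x i else 1)) / 2 ^ n"
proof -
  have sgn: "(- 1 :: real) ^ ((\<Sum>i\<in>S. x i) mod 2) = (\<Prod>i=1..n. if i \<in> S then (- 1) ^ x i else 1)" for x
  proof -
    have "(- 1 :: real) ^ ((\<Sum>i\<in>S. x i) mod 2) = (- 1) ^ (\<Sum>i\<in>S. x i)"
      by (simp add: minus_one_power_iff)
    also have "\<dots> = (\<Prod>i\<in>S. (- 1) ^ x i)"
      by (rule power_sum)
    also have "\<dots> = (\<Prod>i=1..n. if i \<in> S then (- 1) ^ x i else 1)"
      using assms by (simp add: prod.If_cases Int_absorb1)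
    finally show ?thesis .
  qed
  have "card (cube n) = 2 ^ n" "cube n \<noteq> {}"
    by (simp_all add: cube_def card_funcsetE PiE_eq_empty_iff numeral_2_eq_2)
  then show ?thesis
    unfolding fourier_coeff_def sgn by (simp add: integral_pmf_of_set finite_cube)
qed

text \<open>For fixed \<open>x\<close> and \<open>y\<close> the two characters multiply to a product
  of \<open>(- 1) ^ (x i + y i)\<close> over \<open>i\<close> in \<open>S\<close>. Each
  \<open>i\<close> lies in \<open>S\<close> independently with probability \<open>p\<close>, so
  coordinate \<open>i\<close> contributes the average of this sign and 1.\<close>

lemma expectation_fourier_coeff_mult:
  assumes "0 \<le> p" "p \<le> 1"
  shows "measure_pmf.expectation (random_subset n p) (\<lambda>S. fourier_coeff n f S * fourier_coeff n g S)
    = (\<Sum>x\<in>cube n. \<Sum>y\<in>cube n. f x * g y * (\<Prod>i=1..n. 1 - p + p * (- 1) ^ (x i + y i))) / 4 ^ n"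
proof -
  let ?M = "Pi_pmf {1..n} False (\<lambda>_. bernoulli_pmf p)"
  let ?F = "\<lambda>x y b. \<Prod>i=1..n. if b i then (- 1) ^ (x i + y i) else 1 :: real"
  have fin: "finite (set_pmf ?M)"
    by (simp add: set_Pi_pmf finite_PiE_dflt)
  have int: "integrable ?M h" for h :: "_ \<Rightarrow> real"
    by (rule integrable_measure_pmf_finite[OF fin])
  have "fourier_coeff n f {i \<in> {1..n}. b i} * fourier_coeff n g {i \<in> {1..n}. b i}
      = (\<Sum>x\<in>cube n. \<Sum>y\<in>cube n. f x * g y * ?F x y b) / 4 ^ n" for b
  proof -
    have split: "?F x y b = (\<Prod>i=1..n. if i \<in> {i \<in> {1..n}. b i} then (- 1) ^ x i else 1)
        * (\<Prod>i=1..n. if i \<in> {i \<in> {1..n}. b i} then (- 1) ^ y i else 1)" for x y :: "nat \<Rightarrow> nat"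
      unfolding prod.distrib[symmetric] by (intro prod.cong) (auto simp: power_add)
    have "(4 :: real) ^ n = 2 ^ n * 2 ^ n"
      by (simp add: power_mult_distrib[symmetric])
    then show ?thesis
      unfolding split by (subst (1 2) fourier_coeff_eq_sum) (auto simp: sum_product mult_ac)
  qed
  then have "measure_pmf.expectation (random_subset n p) (\<lambda>S. fourier_coeff n f S * fourier_coeff n g S)
      = (\<Sum>x\<in>cube n. \<Sum>y\<in>cube n. f x * g y * measure_pmf.expectation ?M (?F x y)) / 4 ^ n"
    by (simp add: random_subset_def int[simplified])
  moreover have "measure_pmf.expectation ?M (?F x y) = (\<Prod>i=1..n. 1 - p + p * (- 1) ^ (x i + y i))"
    for x y :: "nat \<Rightarrow> nat"
    using assms
    by (subst expectation_prod_Pi_pmf_finite[where h = "\<lambda>i b. if b then (- 1) ^ (x i + y i) else 1"])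
      (auto simp: mult_ac intro!: prod.cong)
  ultimately show ?thesis by (simp only:)
qed

section \<open>Assembling the bounds\<close>

theorem lemma2:
  fixes n :: nat and f g :: "(nat \<Rightarrow> nat) \<Rightarrow> real" and p \<alpha> A' :: real
  assumes "n \<ge> 1"
    and "f \<in> cube n \<rightarrow> {-1, 0, 1}" and "g \<in> cube n \<rightarrow> {-1, 0, 1}"
    and "0 < p" "p \<le> 1 / 2"
    and "0 < \<alpha>" "\<alpha> \<le> 1"
    and "max (A_sup \<alpha> p) ((1 - p) * 4 powr (\<alpha> * p)) \<le> A'"
  shows "measure_pmf.expectation (random_subset n p) (\<lambda>S. fourier_coeff n f S * fourier_coeff n g S)
    \<le> 1 / 4 ^ n * A' ^ n * (real (card (Supp n f)) * real (card (Supp n g))) powr (1 - \<alpha> * p)"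
proof -
  define r where "r = 1 - \<alpha> * p"
  define k :: "nat \<Rightarrow> nat \<Rightarrow> real" where "k s t = 1 - p + p * (- 1) ^ (s + t)" for s t
  have "\<alpha> * p \<le> 1 * (1 / 2)"
    using assms by (intro mult_mono) auto
  then have r: "r > 0" by (simp add: r_def)
  have k: "k s t \<ge> 0" for s t
    using assms by (cases "even (s + t)") (auto simp: k_def)
  have A: "0 \<le> A_sup \<alpha> p"
    using A_ratio_nonneg A_sup_upper[of p \<alpha> 0] assms
    by (meson atLeastAtMost_iff order_refl order_trans zero_le_one)
  \<comment> \<open>On the cube \<bar>h\<bar> is 0 or 1, and both values are fixed by a positive
    power.\<close>
  have supp: "(\<Sum>x\<in>cube n. \<bar>h x\<bar> powr (1 / r)) = real (card (Supp n h))"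
    if "h \<in> cube n \<rightarrow> {-1, 0, 1}" for h
  proof -
    have "(\<Sum>x\<in>cube n. \<bar>h x\<bar> powr (1 / r)) = (\<Sum>x\<in>cube n. if h x \<noteq> 0 then 1 else 0)"
      using that by (intro sum.cong) (auto dest!: funcset_mem)
    then show ?thesis
      by (simp add: Supp_def finite_cube flip: sum.inter_filter)
  qed
  \<comment> \<open>The tensor bound asks for non-negative functions; since \<open>k\<close> \<ge>
    0, replacing \<open>f\<close> and \<open>g\<close> by their absolute values can only increase
    the form.\<close>
  have "(\<Sum>x\<in>cube n. \<Sum>y\<in>cube n. f x * g y * (\<Prod>i=1..n. k (x i) (y i)))
      \<le> (\<Sum>x\<in>cube n. \<Sum>y\<in>cube n. \<bar>f x\<bar> * \<bar>g y\<bar> * (\<Prod>i=1..n. k (x i) (y i)))"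
    by (intro sum_mono mult_right_mono prod_nonneg k) (metis abs_ge_self abs_mult)
  also have "\<dots> \<le> A_sup \<alpha> p ^ card {1..n} * (\<Sum>x\<in>cube n. \<bar>f x\<bar> powr (1 / r)) powr r
      * (\<Sum>x\<in>cube n. \<bar>g x\<bar> powr (1 / r)) powr r"
    unfolding cube_def
  proof (rule tensor_bilinear_bound)
    fix a b :: "nat \<Rightarrow> real"
    assume "\<And>s. s \<in> {0, 1} \<Longrightarrow> a s \<ge> 0" "\<And>s. s \<in> {0, 1} \<Longrightarrow> b s \<ge> 0"
    then show "(\<Sum>s\<in>{0, 1}. \<Sum>t\<in>{0, 1}. k s t * a s * b t)
        \<le> A_sup \<alpha> p * (\<Sum>s\<in>{0, 1}. a s powr (1 / r)) powr r * (\<Sum>s\<in>{0, 1}. b s powr (1 / r)) powr r"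
      unfolding k_def r_def using assms by (intro noise_kernel_bound)
  qed (use r k A in auto)
  also have "\<dots> = A_sup \<alpha> p ^ n * (real (card (Supp n f)) * real (card (Supp n g))) powr r"
    using assms(2,3) by (simp add: supp powr_mult)
  also have "\<dots> \<le> A' ^ n * (real (card (Supp n f)) * real (card (Supp n g))) powr r"
    using A assms(8) by (intro mult_right_mono power_mono) auto
  finally show ?thesis
    using assms by (simp add: expectation_fourier_coeff_mult k_def r_def divide_right_mono)
qed

end
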